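(* Let $\alpha$ be a constant with $0<\alpha<1/2$. Then there is a positive constant $c$, depending only on $\alpha$, such that for all positive integers $n$ and $d$ with $d=\alpha n$, $$P(n,d)\ \ge\ c\,\frac{n!}{V(n,d-1)}\,\log_2 V_2(n,d-1).$$
   Context: $S_n$ is the group of permutations of $Z_n=\{0,1,\ldots,n-1\}$. The Hamming distance $d(\mathbf{x},\mathbf{y})$ of $\mathbf{x},\mathbf{y}\in S_n$ is the number of $i\in Z_n$ with $\mathbf{x}(i)\neq\mathbf{y}(i)$. An $(n,d)$ permutation array (PA) is a subset $C\subseteq S_n$ in which any two distinct elements have distance at least $d$; $P(n,d)$ is the maximum size of an $(n,d)$ PA. $D_k$ is the number of derangements (permutations without fixed points) of $k$ elements, with $D_0=1$. $V(n,d-1)=\sum_{i=0}^{d-1}\binom{n}{i}D_i$ and $V_2(n,d-1)=\sum_{i=0}^{d-1}\binom{n}{i}$. *)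

theory Defs
  imports Complex_Main "HOL-Combinatorics.Permutations"
begin

definition symm :: "nat \<Rightarrow> (nat \<Rightarrow> nat) set" where
  "symm n = {p. p permutes {0..<n}}"

definition hamming_dist :: "nat \<Rightarrow> (nat \<Rightarrow> nat) \<Rightarrow> (nat \<Rightarrow> nat) \<Rightarrow> nat" where
  "hamming_dist n x y = card {i \<in> {0..<n}. x i \<noteq> y i}"

definition perm_array :: "nat \<Rightarrow> nat \<Rightarrow> (nat \<Rightarrow> nat) set \<Rightarrow> bool" where
  "perm_array n d C \<longleftrightarrow>
     C \<subseteq> symm n \<and> (\<forall>x\<in>C. \<forall>y\<in>C. x \<noteq> y \<longrightarrow> d \<le> hamming_dist n x y)"

(* The set of sizes is finite and nonempty: symm n is finite and the empty set is an array. *)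
definition max_perm_array :: "nat \<Rightarrow> nat \<Rightarrow> nat" where
  "max_perm_array n d = Max {card C |C. perm_array n d C}"

definition derangements :: "nat \<Rightarrow> nat" where
  "derangements k = card {p \<in> symm k. \<forall>i<k. p i \<noteq> i}"

(* V(n, r) and, below, V_2(n, r). *)
definition ball_size :: "nat \<Rightarrow> nat \<Rightarrow> nat" where
  "ball_size n r = (\<Sum>i=0..r. (n choose i) * derangements i)"

definition binary_ball_size :: "nat \<Rightarrow> nat \<Rightarrow> nat" where
  "binary_ball_size n r = (\<Sum>i=0..r. n choose i)"

end

theory Submission
  imports Defs
begin

text \<open>
  Permutation arrays are the independent sets of the graph on \<open>S\<^sub>n\<close> joining permutations at
  distance less than \<open>d\<close>. All its degrees are below \<open>M = V(n, d-1)\<close>. Two random elements of the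
  ball of radius \<open>d - 1\<close> have supports of size about \<open>\<alpha> n\<close> which meet in about \<open>\<alpha>\<^sup>2 n\<close> points, so for
  \<open>\<alpha> < 1/2\<close> they are typically at distance about \<open>2 \<alpha> (1 - \<alpha>) n > \<alpha> n\<close>, and a neighbourhood
  spans at most \<open>exp (- 2 b n) M\<^sup>2\<close> pairs of adjacent vertices for some \<open>b > 0\<close>.

  In a graph with such sparse neighbourhoods, a random independent set \<open>I\<close> drawn with probability
  proportional to \<open>l ^ card I\<close>, where \<open>l = exp (b n) / M\<close>, has expected size at least a constant
  times \<open>n! / M\<close> times \<open>ln (l M) = b n\<close>. Since \<open>log\<^sub>2 V\<^sub>2 \<le> n\<close>, this is enough.
\<close>

section \<open>Independent sets in graphs with sparse neighbourhoods\<close>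

lemma sum_Pow_power_card:
  fixes l :: real
  assumes "finite S"
  shows "(\<Sum>I\<in>Pow S. l ^ card I) = (1 + l) ^ card S"
  using prod_add[OF assms, of "\<lambda>_. l" "\<lambda>_. 1"] by (simp add: add.commute)

lemma sum_Un_le:
  fixes f :: "'a \<Rightarrow> real"
  assumes "finite A" "finite B" "\<And>x. 0 \<le> f x"
  shows "sum f (A \<union> B) \<le> sum f A + sum f B"
  using sum_nonneg[of "A \<inter> B" f] assms by (simp add: sum_Un)

lemma sum_UN_le:
  fixes f :: "'a \<Rightarrow> real"
  assumes "finite W" "\<And>w. w \<in> W \<Longrightarrow> finite (A w)" "\<And>x. 0 \<le> f x"
  shows "sum f (\<Union>w\<in>W. A w) \<le> (\<Sum>w\<in>W. sum f (A w))"
  using assms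
proof (induction W)
  case (insert w W)
  have "sum f (\<Union>w\<in>insert w W. A w) \<le> sum f (A w) + sum f (\<Union>w\<in>W. A w)"
    using insert sum_Un_le[of "A w" "\<Union>w\<in>W. A w" f] by simp
  with insert show ?case by simp
qed simp

section \<open>The hard-core model: independent sets \<open>I\<close> weighted by
  \<open>l ^ card I\<close>\<close>

locale finite_graph =
  fixes V :: "'a set" and E :: "'a \<Rightarrow> 'a \<Rightarrow> bool"
  assumes finite_V: "finite V"
    and sym: "E x y \<Longrightarrow> E y x"
    and irrefl: "\<not> E x x"
begin

definition indep :: "'a set \<Rightarrow> 'a set set" where
  "indep S = {I. I \<subseteq> S \<and> (\<forall>x\<in>I. \<forall>y\<in>I. \<not> E x y)}"

definition nbhd :: "'a \<Rightarrow> 'a set" where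
  "nbhd v = {u \<in> V. E v u}"

text \<open>This is the normalising constant of the hard-core model with fugacity \<open>l\<close>.
  Dividing \<open>partition_fun_at l S u\<close> by it gives the probability that the random
  independent set contains \<open>u\<close>; working with unnormalised sums avoids a probability
  space.\<close>

definition partition_fun :: "real \<Rightarrow> 'a set \<Rightarrow> real" where
  "partition_fun l S = (\<Sum>I\<in>indep S. l ^ card I)"

definition partition_fun_at :: "real \<Rightarrow> 'a set \<Rightarrow> 'a \<Rightarrow> real" where
  "partition_fun_at l S u = (\<Sum>I\<in>{I \<in> indep S. u \<in> I}. l ^ card I)"

lemma finite_indep: "finite S \<Longrightarrow> finite (indep S)"
  by (rule finite_subset[of _ "Pow S"]) (auto simp: indep_def)

lemma finite_mem_indep: "finite S \<Longrightarrow> I \<in> indep S \<Longrightarrow> finite I"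
  by (auto simp: indep_def intro: finite_subset)

lemma partition_fun_ge_1:
  assumes "finite S" "0 < l"
  shows "1 \<le> partition_fun l S"
proof -
  have "(\<Sum>I\<in>{{} :: 'a set}. l ^ card I) \<le> partition_fun l S"
    unfolding partition_fun_def
    by (rule sum_mono2[OF finite_indep]) (use assms in \<open>auto simp: indep_def\<close>)
  then show ?thesis by simp
qed

lemma partition_fun_le_exp:
  assumes "finite S" "0 < l"
  shows "partition_fun l S \<le> exp (l * card S)"
proof -
  have "partition_fun l S \<le> (\<Sum>I\<in>Pow S. l ^ card I)"
    unfolding partition_fun_def
    by (rule sum_mono2) (use assms in \<open>auto simp: indep_def\<close>)
  also have "\<dots> = (1 + l) ^ card S"
    using assms by (simp add: sum_Pow_power_card)
  also have "\<dots> \<le> exp l ^ card S"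
    using assms by (intro power_mono) auto
  also have "\<dots> = exp (l * card S)"
    by (simp add: exp_of_nat_mult[symmetric] mult.commute)
  finally show ?thesis .
qed

text \<open>Deleting \<open>u\<close> maps the independent sets through \<open>u\<close> injectively
  to independent sets and divides the weight by \<open>l\<close>. So every vertex is occupied with
  probability at most \<open>l\<close>.\<close>

lemma partition_fun_at_le:
  assumes "finite S" "0 < l"
  shows "partition_fun_at l S u \<le> l * partition_fun l S"
proof -
  let ?A = "{I \<in> indep S. u \<in> I}"
  have "partition_fun_at l S u = (\<Sum>I\<in>?A. l * l ^ card (I - {u}))"
    unfolding partition_fun_at_def
  proof (rule sum.cong[OF refl])
    fix I assume I: "I \<in> ?A"
    then have "card I = Suc (card (I - {u}))"
      using finite_mem_indep[OF assms(1)] by (metis (lifting) card.remove mem_Collect_eq)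
    then show "l ^ card I = l * l ^ card (I - {u})" by simp
  qed
  also have "\<dots> = l * (\<Sum>I\<in>(\<lambda>I. I - {u}) ` ?A. l ^ card I)"
    by (subst sum.reindex) (auto simp: inj_on_def sum_distrib_left)
  also have "\<dots> \<le> l * partition_fun l S"
    unfolding partition_fun_def
    by (intro mult_left_mono sum_mono2)
      (use assms finite_indep in \<open>auto simp: indep_def\<close>)
  finally show ?thesis .
qed

text \<open>An independent set contains \<open>u\<close>, or contains a neighbour of
  \<open>u\<close>, or can be enlarged by \<open>u\<close>. Sets of the third kind inject into those
  of the first kind with weights multiplied by \<open>l\<close>, whence the term
  \<open>1 / l\<close>.\<close>

lemma partition_fun_le_at:
  assumes "finite S" "0 < l" "u \<in> S"
  shows "partition_fun l S \<le> (1 + 1 / l) * partition_fun_at l S u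
     + (\<Sum>w\<in>{w \<in> S. E u w}. partition_fun_at l S w)"
proof -
  let ?f = "\<lambda>I. l ^ card I" and ?N = "{w \<in> S. E u w}"
  let ?A = "{I \<in> indep S. u \<in> I}" and ?B = "{I \<in> indep S. u \<notin> I \<and> I \<inter> ?N = {}}"
  let ?C = "\<Union>w\<in>?N. {I \<in> indep S. w \<in> I}"
  have fin: "finite (indep S)" using assms by (simp add: finite_indep)
  have "sum ?f ?B = (1 / l) * (\<Sum>I\<in>?B. l ^ card (insert u I))"
    unfolding sum_distrib_left
    by (rule sum.cong) (use assms finite_mem_indep in auto)
  also have "(\<Sum>I\<in>?B. l ^ card (insert u I)) = sum ?f (insert u ` ?B)"
    by (subst sum.reindex) (auto simp: inj_on_def)
  also have "\<dots> \<le> sum ?f ?A"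
  proof (rule sum_mono2)
    show "insert u ` ?B \<subseteq> ?A"
      using assms by (auto simp: indep_def irrefl dest: sym)
  qed (use assms fin in auto)
  finally have B: "sum ?f ?B \<le> (1 / l) * sum ?f ?A"
    using assms by (simp add: divide_right_mono)
  have "partition_fun l S \<le> sum ?f (?A \<union> ?B \<union> ?C)"
    unfolding partition_fun_def
    by (rule sum_mono2) (use assms fin in auto)
  also have "\<dots> \<le> sum ?f (?A \<union> ?B) + sum ?f ?C"
    using assms fin by (intro sum_Un_le) auto
  also have "sum ?f (?A \<union> ?B) \<le> sum ?f ?A + sum ?f ?B"
    using assms fin by (intro sum_Un_le) auto
  also have "sum ?f ?C \<le> (\<Sum>w\<in>?N. partition_fun_at l S w)"
    unfolding partition_fun_at_def
    by (rule sum_UN_le) (use assms fin in auto)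
  finally show ?thesis
    using B by (simp add: partition_fun_at_def algebra_simps)
qed

text \<open>Sum \<open>partition_fun_le_at\<close> over all \<open>u\<close> in \<open>S\<close>,
  bounding each neighbour's occupation probability by \<open>l\<close>; the neighbour terms then
  count ordered adjacent pairs. Divided by \<open>partition_fun l S\<close>, the result bounds the
  expected size of the random independent set from below: with few edges it is nearly
  \<open>l * card S / (1 + l)\<close>.\<close>

lemma occupancy_ge:
  fixes l T :: real
  assumes "finite S" "0 < l" and T: "real (card {(x, y). x \<in> S \<and> y \<in> S \<and> E x y}) \<le> T"
  shows "l * (card S - l * T) * partition_fun l S
    \<le> (1 + l) * (\<Sum>I\<in>indep S. l ^ card I * card I)"
proof -
  let ?Z = "partition_fun l S" and ?N = "\<lambda>u. {w \<in> S. E u w}"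
  have pairs: "{(x, y). x \<in> S \<and> y \<in> S \<and> E x y} = Sigma S ?N" by auto
  have "card {(x, y). x \<in> S \<and> y \<in> S \<and> E x y} = (\<Sum>u\<in>S. card (?N u))"
    unfolding pairs using assms(1) by (intro card_SigmaI) auto
  then have T': "(\<Sum>u\<in>S. real (card (?N u))) \<le> T"
    using T by (simp only: of_nat_sum)
  have Z: "1 \<le> ?Z" using assms by (intro partition_fun_ge_1)
  have "l * ?Z \<le> (1 + l) * partition_fun_at l S u + l\<^sup>2 * ?Z * card (?N u)" if "u \<in> S" for u
  proof -
    have "?Z \<le> (1 + 1 / l) * partition_fun_at l S u + (\<Sum>w\<in>?N u. partition_fun_at l S w)"
      by (rule partition_fun_le_at[OF assms(1,2) that])
    also have "(\<Sum>w\<in>?N u. partition_fun_at l S w) \<le> (\<Sum>w\<in>?N u. l * ?Z)"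
      by (intro sum_mono partition_fun_at_le assms)
    finally have "l * ?Z \<le> l * ((1 + 1 / l) * partition_fun_at l S u + card (?N u) * (l * ?Z))"
      using assms by simp
    also have "l * ((1 + 1 / l) * partition_fun_at l S u + card (?N u) * (l * ?Z))
        = (1 + l) * partition_fun_at l S u + l\<^sup>2 * ?Z * card (?N u)"
      using \<open>0 < l\<close> by (simp add: algebra_simps power2_eq_square)
    finally show ?thesis .
  qed
  then have "(\<Sum>u\<in>S. l * ?Z)
      \<le> (\<Sum>u\<in>S. (1 + l) * partition_fun_at l S u + l\<^sup>2 * ?Z * card (?N u))"
    by (intro sum_mono)
  also have "\<dots> = (1 + l) * (\<Sum>u\<in>S. partition_fun_at l S u)
      + l\<^sup>2 * ?Z * (\<Sum>u\<in>S. real (card (?N u)))"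
    by (simp add: sum.distrib sum_distrib_left)
  also have "\<dots> \<le> (1 + l) * (\<Sum>u\<in>S. partition_fun_at l S u) + l\<^sup>2 * ?Z * T"
    using T' Z assms by (intro add_left_mono mult_left_mono) auto
  \<comment> \<open>Double counting: a set \<open>I\<close> contributes its weight once for each of
    its elements.\<close>
  also have "(\<Sum>u\<in>S. partition_fun_at l S u)
      = (\<Sum>u\<in>S. \<Sum>I\<in>indep S. if u \<in> I then l ^ card I else 0)"
    unfolding partition_fun_at_def by (simp only: sum.inter_filter[OF finite_indep[OF assms(1)]])
  also have "\<dots> = (\<Sum>I\<in>indep S. \<Sum>u\<in>S. if u \<in> I then l ^ card I else 0)"
    by (rule sum.swap)
  also have "\<dots> = (\<Sum>I\<in>indep S. l ^ card I * card I)"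
  proof (rule sum.cong[OF refl])
    fix I assume "I \<in> indep S"
    then have "{u \<in> S. u \<in> I} = I" by (auto simp: indep_def)
    then show "(\<Sum>u\<in>S. if u \<in> I then l ^ card I else 0) = l ^ card I * card I"
      using assms(1) by (simp add: sum.If_cases Int_def)
  qed
  finally have "card S * (l * ?Z)
      \<le> (1 + l) * (\<Sum>I\<in>indep S. l ^ card I * card I) + l\<^sup>2 * ?Z * T"
    by simp
  moreover have "l * (card S - l * T) * ?Z = card S * (l * ?Z) - l\<^sup>2 * ?Z * T"
    by (simp add: algebra_simps power2_eq_square)
  ultimately show ?thesis by linarith
qed

text \<open>With few free neighbours of \<open>v\<close> the vertex \<open>v\<close> itself has a decent chance of being chosen;
  with many of them, the sparsity of the neighbourhood forces many neighbours to be chosen.\<close>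

lemma local_occupancy_ge:
  fixes l L M T :: real
  assumes "finite X" "0 < l" "l \<le> 1"
    and T: "real (card {(x, y). x \<in> X \<and> y \<in> X \<and> E x y}) \<le> T" "l\<^sup>2 * T \<le> 1"
    and L: "0 \<le> L" "exp (2 + 6 * L) \<le> l * M"
  shows "L * (l + partition_fun l X) \<le> M * l + (\<Sum>I\<in>indep X. l ^ card I * card I)"
proof -
  let ?Z = "partition_fun l X" and ?S = "\<Sum>I\<in>indep X. l ^ card I * card I"
  have Z: "1 \<le> ?Z" using assms by (intro partition_fun_ge_1)
  have S: "0 \<le> ?S" using \<open>0 < l\<close> by (intro sum_nonneg) auto
  show ?thesis
  \<comment> \<open>If \<open>X\<close> is large, its expected occupancy is at least
    \<open>2 * L\<close>: one factor 2 of \<open>4 * L\<close> is lost to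
    \<open>1 + l \<le> 2\<close>, the other to \<open>l + ?Z \<le> 2 * ?Z\<close>. If
    \<open>X\<close> is small, \<open>?Z \<le> exp (1 + 4 * L)\<close>, and the term
    \<open>M * l\<close> suffices alone: the remaining \<open>exp (1 + 2 * L)\<close> pays for the
    factors 2 and \<open>L\<close>.\<close>
  proof (cases "l * card X \<ge> 1 + 4 * L")
    case True
    have "4 * L \<le> l * card X - l\<^sup>2 * T" using True T(2) by simp
    then have "(4 * L) * ?Z \<le> (l * card X - l\<^sup>2 * T) * ?Z"
      using Z by (intro mult_right_mono) auto
    also have "\<dots> = l * (card X - l * T) * ?Z" by (simp add: algebra_simps power2_eq_square)
    also have "\<dots> \<le> (1 + l) * ?S" by (rule occupancy_ge[OF assms(1,2) T(1)])
    also have "\<dots> \<le> 2 * ?S" using \<open>l \<le> 1\<close> S by (intro mult_right_mono) auto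
    finally have "L * (2 * ?Z) \<le> ?S" by simp
    moreover have "L * (l + ?Z) \<le> L * (2 * ?Z)"
      using Z \<open>l \<le> 1\<close> L(1) by (intro mult_left_mono) auto
    moreover have "0 \<le> M * l" using L(2) by (metis exp_ge_zero mult.commute order_trans)
    ultimately show ?thesis by linarith
  next
    case False
    have "?Z \<le> exp (l * card X)" by (rule partition_fun_le_exp[OF assms(1,2)])
    also have "\<dots> \<le> exp (1 + 4 * L)" using False by simp
    finally have "l + ?Z \<le> 2 * exp (1 + 4 * L)" using Z \<open>l \<le> 1\<close> by linarith
    also have "\<dots> \<le> exp 1 * exp (1 + 4 * L)"
      using exp_ge_add_one_self[of 1] by (intro mult_right_mono) auto
    also have "\<dots> = exp (2 + 4 * L)" by (simp add: exp_add[symmetric])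
    finally have "L * (l + ?Z) \<le> exp (2 * L) * exp (2 + 4 * L)"
      using exp_ge_add_one_self[of "2 * L"] L(1) Z \<open>0 < l\<close>
      by (intro mult_mono) linarith+
    also have "\<dots> = exp (2 + 6 * L)" by (simp add: exp_add[symmetric])
    finally show ?thesis using L(2) S by (simp add: mult.commute)
  qed
qed

lemma indep_mono: "I \<in> indep S \<Longrightarrow> J \<subseteq> I \<Longrightarrow> J \<in> indep S"
  by (auto simp: indep_def)

text \<open>Condition on the part \<open>H\<close> of the random independent set that lies outside
  \<open>v\<close> and its neighbourhood. Given \<open>H\<close>, what remains is a hard-core model
  on \<open>v\<close> and its free neighbours, to which \<open>local_occupancy_ge\<close> applies;
  summing over all \<open>H\<close> gives the claim.\<close>

lemma vertex_occupancy_ge: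
  fixes l L M T :: real
  assumes v: "v \<in> V" and l: "0 < l" "l \<le> 1"
    and T: "real (card {(x, y). x \<in> nbhd v \<and> y \<in> nbhd v \<and> E x y}) \<le> T" "l\<^sup>2 * T \<le> 1"
    and L: "0 \<le> L" "exp (2 + 6 * L) \<le> l * M"
  shows "L * partition_fun l V
    \<le> (\<Sum>I\<in>indep V. l ^ card I * (M * of_bool (v \<in> I) + card (nbhd v \<inter> I)))"
proof -
  let ?N = "nbhd v"
  let ?W = "insert v ?N"
  let ?g = "\<lambda>I. I - ?W" and ?f = "\<lambda>I. l ^ card I * (M * of_bool (v \<in> I) + card (?N \<inter> I))"
  have fin: "finite (indep V)" using finite_V finite_indep by blast
  have vN: "v \<notin> ?N" by (simp add: nbhd_def irrefl)
  have fibre: "L * (\<Sum>I\<in>{I \<in> indep V. ?g I = H}. l ^ card I) \<le> sum ?f {I \<in> indep V. ?g I = H}"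
    if H: "H \<in> ?g ` indep V" for H
  proof -
    have HW: "H \<inter> ?W = {}" and HI: "H \<in> indep V" using H indep_mono by auto
    then have HV: "H \<subseteq> V" by (simp add: indep_def)
    have finH: "finite H" using HI finite_mem_indep finite_V by blast
    \<comment> \<open>These are the neighbours of \<open>v\<close> that \<open>H\<close> does not
      block. A completion of \<open>H\<close> is either \<open>v\<close> alone, which
      \<open>H\<close> never blocks and which excludes all of \<open>?N\<close>, or any independent
      subset of \<open>X\<close>; so its total relative weight is
      \<open>l + partition_fun l X\<close>.\<close>
    define X where "X = {u \<in> ?N. \<forall>h\<in>H. \<not> E u h}"
    have XN: "X \<subseteq> ?N" and XV: "X \<subseteq> V" by (auto simp: X_def nbhd_def)
    have finX: "finite X" using XV finite_V finite_subset by blast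
    have eq: "{I \<in> indep V. ?g I = H} = insert (insert v H) ((\<union>) H ` indep X)"
    proof (intro equalityI subsetI)
      fix I assume I: "I \<in> {I \<in> indep V. ?g I = H}"
      show "I \<in> insert (insert v H) ((\<union>) H ` indep X)"
      proof (cases "v \<in> I")
        case True
        then have "I \<inter> ?N = {}" using I by (auto simp: indep_def nbhd_def)
        then have "I = insert v H" using I True by auto
        then show ?thesis by simp
      next
        case False
        then have "I = H \<union> (I \<inter> ?N)" using I by auto
        moreover have "I \<inter> ?N \<in> indep X"
          using I by (auto simp: indep_def X_def)
        ultimately show ?thesis by blast
      qed
    next
      fix I assume "I \<in> insert (insert v H) ((\<union>) H ` indep X)"
      then consider "I = insert v H" | J where "J \<in> indep X" "I = H \<union> J" by auto
      then show "I \<in> {I \<in> indep V. ?g I = H}"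
      proof cases
        case 1
        have "\<not> E v h \<and> \<not> E h v" if "h \<in> H" for h
          using that HW HV sym by (auto simp: nbhd_def)
        then have "insert v H \<in> indep V"
          using HI v by (auto simp: indep_def irrefl)
        moreover have "?g I = H" using 1 HW by auto
        ultimately show ?thesis using 1 by simp
      next
        case 2
        have "J \<subseteq> X" using 2 by (simp add: indep_def)
        then have "\<not> E j h \<and> \<not> E h j" if "h \<in> H" "j \<in> J" for h j
          using that sym by (auto simp: X_def)
        then have "H \<union> J \<in> indep V"
          using HI 2 \<open>J \<subseteq> X\<close> XV by (auto simp: indep_def)
        moreover have "?g I = H" using 2 HW \<open>J \<subseteq> X\<close> XN by auto
        ultimately show ?thesis using 2 by simp
      qed
    qed
    have ins: "insert v H \<notin> (\<union>) H ` indep X"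
      using HW vN XN by (auto simp: indep_def)
    have inj: "inj_on ((\<union>) H) (indep X)"
    proof (rule inj_onI)
      fix I J assume "I \<in> indep X" "J \<in> indep X" and IJ: "H \<union> I = H \<union> J"
      then have "I \<inter> H = {}" "J \<inter> H = {}" using HW XN by (auto simp: indep_def)
      with IJ show "I = J" by blast
    qed
    have card_v: "card (insert v H) = Suc (card H)"
      using HW finH by simp
    have J: "finite J" "J \<inter> H = {}" "?N \<inter> (H \<union> J) = J" "v \<notin> J" if "J \<in> indep X" for J
      using that finite_mem_indep[OF finX] HW XN vN by (auto simp: indep_def)
    have card_J: "card (H \<union> J) = card H + card J" if "J \<in> indep X" for J
      using J[OF that] finH by (simp add: card_Un_disjoint Int_commute)
    have NvH: "?N \<inter> insert v H = {}" using HW vN by auto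
    have vH: "v \<notin> H" using HW by auto
    have sum_eq: "sum \<phi> {I \<in> indep V. ?g I = H} = \<phi> (insert v H) + (\<Sum>J\<in>indep X. \<phi> (H \<union> J))"
      for \<phi> :: "'a set \<Rightarrow> real"
      unfolding eq using ins inj finX finite_indep
      by (subst sum.insert) (auto simp: sum.reindex)
    have "(\<Sum>I\<in>{I \<in> indep V. ?g I = H}. l ^ card I) = l ^ card H * (l + partition_fun l X)"
      unfolding sum_eq partition_fun_def
      by (simp add: card_v card_J power_add sum_distrib_left distrib_left)
    moreover have "sum ?f {I \<in> indep V. ?g I = H}
        = l ^ card H * (M * l + (\<Sum>J\<in>indep X. l ^ card J * card J))"
      unfolding sum_eq
      by (simp add: card_v card_J power_add sum_distrib_left distrib_left NvH J vH mult.assoc)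
    moreover have "L * (l + partition_fun l X) \<le> M * l + (\<Sum>J\<in>indep X. l ^ card J * card J)"
    proof (rule local_occupancy_ge)
      have "card {(x, y). x \<in> X \<and> y \<in> X \<and> E x y} \<le> card {(x, y). x \<in> ?N \<and> y \<in> ?N \<and> E x y}"
        by (rule card_mono, rule finite_subset[of _ "V \<times> V"])
          (use XN finite_V in \<open>auto simp: nbhd_def\<close>)
      then show "real (card {(x, y). x \<in> X \<and> y \<in> X \<and> E x y}) \<le> T"
        using T by linarith
    qed (use assms finX in auto)
    ultimately show ?thesis
      using l by (simp add: mult.left_commute)
  qed
  have "L * partition_fun l V
      = (\<Sum>H\<in>?g ` indep V. L * (\<Sum>I\<in>{I \<in> indep V. ?g I = H}. l ^ card I))"
    unfolding partition_fun_def by (subst sum.image_gen[OF fin, of _ ?g]) (simp add: sum_distrib_left)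
  also have "\<dots> \<le> (\<Sum>H\<in>?g ` indep V. sum ?f {I \<in> indep V. ?g I = H})"
    by (intro sum_mono fibre)
  also have "\<dots> = sum ?f (indep V)"
    by (rule sum.image_gen[OF fin, symmetric])
  finally show ?thesis .
qed

text \<open>Sum \<open>vertex_occupancy_ge\<close> over all vertices. A set \<open>I\<close>
  collects \<open>M * card I\<close> from its own members and at most as much from neighbourhoods,
  since each chosen vertex lies in at most \<open>M\<close> of them; hence the factor 2. Some
  \<open>I\<close> does at least as well as the weighted average.\<close>

lemma ex_large_independent_set:
  fixes l L M T :: real
  assumes l: "0 < l" "l \<le> 1"
    and M: "\<And>v. v \<in> V \<Longrightarrow> real (card (nbhd v)) \<le> M"
    and T: "\<And>v. v \<in> V \<Longrightarrow> real (card {(x, y). x \<in> nbhd v \<and> y \<in> nbhd v \<and> E x y}) \<le> T"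
      "l\<^sup>2 * T \<le> 1"
    and L: "0 \<le> L" "exp (2 + 6 * L) \<le> l * M"
  shows "\<exists>I\<in>indep V. L * card V \<le> 2 * M * card I"
proof (rule ccontr)
  assume "\<not> ?thesis"
  then have small: "2 * M * card I < L * card V" if "I \<in> indep V" for I
    using that by (auto simp: not_le)
  let ?f = "\<lambda>v I. M * of_bool (v \<in> I) + real (card (nbhd v \<inter> I))"
  have fin: "finite (indep V)" using finite_V finite_indep by blast
  have total: "(\<Sum>v\<in>V. ?f v I) \<le> 2 * M * card I" if I: "I \<in> indep V" for I
  proof -
    have IV: "I \<subseteq> V" "finite I" using I finite_V finite_mem_indep by (auto simp: indep_def)
    have "(\<Sum>v\<in>V. real (card (nbhd v \<inter> I))) = (\<Sum>v\<in>V. \<Sum>u\<in>I. of_bool (E v u))"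
      using IV by (intro sum.cong refl) (auto simp: nbhd_def Int_def intro!: arg_cong[where f = card])
    also have "\<dots> = (\<Sum>u\<in>I. \<Sum>v\<in>V. of_bool (E v u))" by (rule sum.swap)
    also have "\<dots> = (\<Sum>u\<in>I. real (card (nbhd u)))"
      using finite_V sym by (intro sum.cong refl) (auto simp: nbhd_def Int_def intro!: arg_cong[where f = card])
    also have "\<dots> \<le> (\<Sum>u\<in>I. M)" using IV M by (intro sum_mono) auto
    finally have "(\<Sum>v\<in>V. real (card (nbhd v \<inter> I))) \<le> M * card I" by (simp add: mult.commute)
    moreover have "V \<inter> {v. v \<in> I} = I" using IV by auto
    then have "(\<Sum>v\<in>V. M * of_bool (v \<in> I)) = M * card I"
      using finite_V by (simp add: sum_distrib_left[symmetric])
    ultimately show ?thesis by (simp add: sum.distrib)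
  qed
  have "L * card V * partition_fun l V = (\<Sum>v\<in>V. L * partition_fun l V)" by simp
  also have "\<dots> \<le> (\<Sum>v\<in>V. \<Sum>I\<in>indep V. l ^ card I * ?f v I)"
    using vertex_occupancy_ge[OF _ l T L] by (intro sum_mono) auto
  also have "\<dots> = (\<Sum>I\<in>indep V. l ^ card I * (\<Sum>v\<in>V. ?f v I))"
    by (subst sum.swap) (simp add: sum_distrib_left)
  also have "\<dots> < (\<Sum>I\<in>indep V. l ^ card I * (L * card V))"
  proof (rule sum_strict_mono[OF fin])
    show "indep V \<noteq> {}" by (auto simp: indep_def)
    show "l ^ card I * (\<Sum>v\<in>V. ?f v I) < l ^ card I * (L * card V)" if "I \<in> indep V" for I
      using total[OF that] small[OF that] l by (intro mult_strict_left_mono) auto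
  qed
  also have "\<dots> = L * card V * partition_fun l V"
    by (simp add: partition_fun_def sum_distrib_right[symmetric] mult.commute)
  finally show False by simp
qed

end

section \<open>Hypergeometric moments\<close>

text \<open>The ratio of the two binomials is the probability that a random \<open>j\<close>-subset
  contains \<open>k\<close> given points, namely the product of \<open>(j - i) / (n - i)\<close>
  over \<open>i < k\<close>. Each factor is at most \<open>j / n\<close>.\<close>

lemma choose_diff_le:
  assumes "k \<le> j" "j \<le> n"
  shows "real ((n - k) choose (j - k)) \<le> real (n choose j) * (real j / real n) ^ k"
  using assms(1)
proof (induction k)
  case (Suc k)
  have "real ((n - Suc k) choose (j - Suc k)) = real (j - k) / real (n - k) * real ((n - k) choose (j - k))"
  proof -
    have "(j - k) * ((n - k) choose (j - k)) = (n - k) * ((n - k - 1) choose (j - k - 1))"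
      using Suc by (intro times_binomial_minus1_eq) auto
    then have "real (j - k) * real ((n - k) choose (j - k)) = real (n - k) * real ((n - Suc k) choose (j - Suc k))"
      by (metis diff_Suc_eq_diff_pred diff_commute of_nat_mult)
    then show ?thesis using Suc assms by (simp add: field_simps)
  qed
  also have "\<dots> \<le> real j / real n * (real (n choose j) * (real j / real n) ^ k)"
  proof (rule mult_mono)
    have "real k * real j \<le> real k * real n" using assms by (intro mult_left_mono) auto
    then show "real (j - k) / real (n - k) \<le> real j / real n"
      using Suc assms by (simp add: field_simps of_nat_diff)
  qed (use Suc in auto)
  finally show ?case by (simp add: mult_ac)
qed simp

lemma card_supersets:
  assumes "finite U" "K \<subseteq> U" "card K \<le> j"
  shows "card {S. S \<subseteq> U \<and> card S = j \<and> K \<subseteq> S} = (card U - card K) choose (j - card K)"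
proof -
  have K: "finite K" using assms finite_subset by blast
  have "bij_betw (\<lambda>R. R \<union> K) {R. R \<subseteq> U - K \<and> card R = j - card K} {S. S \<subseteq> U \<and> card S = j \<and> K \<subseteq> S}"
  proof (rule bij_betw_byWitness[where f' = "\<lambda>S. S - K"])
    have "card (R \<union> K) = j" if "R \<subseteq> U - K" "card R = j - card K" for R
    proof -
      have "finite R" "R \<inter> K = {}" using that assms finite_subset by blast+
      then show ?thesis using that assms K by (simp add: card_Un_disjoint)
    qed
    then show "(\<lambda>R. R \<union> K) ` {R. R \<subseteq> U - K \<and> card R = j - card K} \<subseteq> {S. S \<subseteq> U \<and> card S = j \<and> K \<subseteq> S}"
      using assms by auto
    show "(\<lambda>S. S - K) ` {S. S \<subseteq> U \<and> card S = j \<and> K \<subseteq> S} \<subseteq> {R. R \<subseteq> U - K \<and> card R = j - card K}"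
      using K by (auto simp: card_Diff_subset)
  qed auto
  then show ?thesis
    using n_subsets[of "U - K"] assms K by (simp add: bij_betw_same_card[symmetric] card_Diff_subset)
qed

text \<open>Expand \<open>(1 + s) ^ card (A \<inter> S)\<close> over the subsets \<open>K\<close> of
  \<open>A \<inter> S\<close>. A random \<open>S\<close> contains \<open>K\<close> with probability
  at most \<open>(j / card U) ^ card K\<close>, so the hypergeometric moment is dominated by the
  binomial one.\<close>

lemma hypergeometric_mgf_le:
  fixes s :: real
  assumes U: "finite U" and A: "A \<subseteq> U" and s: "0 \<le> s" and j: "j \<le> card U"
  shows "(\<Sum>S | S \<subseteq> U \<and> card S = j. (1 + s) ^ card (A \<inter> S))
    \<le> (1 + s * (real j / card U)) ^ card A * real (card U choose j)"
proof -
  let ?F = "{S. S \<subseteq> U \<and> card S = j}" and ?r = "real j / card U"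
  have finA: "finite A" using U A finite_subset by blast
  have finF: "finite ?F" using U by simp
  have "(\<Sum>S\<in>?F. (1 + s) ^ card (A \<inter> S)) = (\<Sum>S\<in>?F. \<Sum>K\<in>Pow A. if K \<subseteq> S then s ^ card K else 0)"
  proof (rule sum.cong[OF refl])
    fix S
    have "(1 + s) ^ card (A \<inter> S) = (\<Sum>K\<in>Pow (A \<inter> S). s ^ card K)"
      using finA by (subst sum_Pow_power_card) auto
    also have "\<dots> = (\<Sum>K\<in>Pow A. if K \<subseteq> S then s ^ card K else 0)"
      using finA by (intro sum.mono_neutral_cong_left) auto
    finally show "(1 + s) ^ card (A \<inter> S) = (\<Sum>K\<in>Pow A. if K \<subseteq> S then s ^ card K else 0)" .
  qed
  also have "\<dots> = (\<Sum>K\<in>Pow A. \<Sum>S\<in>?F. if K \<subseteq> S then s ^ card K else 0)"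
    by (rule sum.swap)
  also have "\<dots> = (\<Sum>K\<in>Pow A. s ^ card K * card {S. S \<subseteq> U \<and> card S = j \<and> K \<subseteq> S})"
    using finF by (intro sum.cong refl)
      (auto simp: sum.If_cases Int_def conj_assoc mult.commute intro!: arg_cong[where f = card])
  also have "\<dots> \<le> (\<Sum>K\<in>Pow A. s ^ card K * (real (card U choose j) * ?r ^ card K))"
  proof (intro sum_mono mult_left_mono)
    fix K assume K: "K \<in> Pow A"
    show "real (card {S. S \<subseteq> U \<and> card S = j \<and> K \<subseteq> S}) \<le> real (card U choose j) * ?r ^ card K"
    proof (cases "card K \<le> j")
      case True
      then show ?thesis using card_supersets[OF U _ True] choose_diff_le[OF True j] K A by auto
    next
      case False
      then have "{S. S \<subseteq> U \<and> card S = j \<and> K \<subseteq> S} = {}"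
        using U by (auto dest: card_mono finite_subset)
      then show ?thesis by (simp only: card.empty) simp
    qed
  qed (use s in simp)
  also have "\<dots> = (\<Sum>K\<in>Pow A. (s * ?r) ^ card K) * real (card U choose j)"
    unfolding sum_distrib_right power_mult_distrib by (intro sum.cong refl) (simp only: mult_ac)
  also have "\<dots> = (1 + s * ?r) ^ card A * real (card U choose j)"
    using sum_Pow_power_card[OF finA] by simp
  finally show ?thesis .
qed

section \<open>Supports and balls\<close>

definition moved :: "nat \<Rightarrow> (nat \<Rightarrow> nat) \<Rightarrow> nat set" where
  "moved n x = {i \<in> {0..<n}. x i \<noteq> i}"

text \<open>The Hamming ball about the identity: \<open>moved n x\<close> is where \<open>x\<close>
  differs from \<open>id\<close>.\<close>

definition ball :: "nat \<Rightarrow> nat \<Rightarrow> (nat \<Rightarrow> nat) set" where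
  "ball n r = {x \<in> symm n. card (moved n x) \<le> r}"

lemma finite_symm: "finite (symm n)"
  by (simp add: symm_def finite_permutations)

lemma finite_ball: "finite (ball n r)"
  by (simp add: ball_def finite_symm)

lemma finite_moved: "finite (moved n x)"
  by (simp add: moved_def)

text \<open>A permutation with support exactly \<open>S\<close> is a derangement of
  \<open>S\<close>, and relabelling \<open>S\<close> by a bijection does not change how many there
  are.\<close>

lemma card_moved_eq:
  assumes "S \<subseteq> {0..<n}"
  shows "card {x \<in> symm n. moved n x = S} = derangements (card S)"
proof -
  have "finite S" using assms finite_subset by blast
  then obtain f where f: "bij_betw f {0..<card S} S"
    using ex_bij_betw_nat_finite by blast
  have "{x \<in> symm n. moved n x = S} = {\<pi>. \<pi> permutes S \<and> (\<forall>x\<in>S. \<pi> x \<noteq> x)}"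
  proof (intro equalityI subsetI)
    fix x assume "x \<in> {x \<in> symm n. moved n x = S}"
    then have x: "x permutes {0..<n}" "moved n x = S" by (auto simp: symm_def)
    then have "x permutes S"
      by (intro permutes_superset[OF x(1)]) (auto simp: moved_def)
    then show "x \<in> {\<pi>. \<pi> permutes S \<and> (\<forall>x\<in>S. \<pi> x \<noteq> x)}" using x by (auto simp: moved_def)
  next
    fix x assume "x \<in> {\<pi>. \<pi> permutes S \<and> (\<forall>x\<in>S. \<pi> x \<noteq> x)}"
    then have x: "x permutes S" "\<forall>i\<in>S. x i \<noteq> i" by auto
    then have "x permutes {0..<n}" using assms permutes_subset by blast
    moreover have "moved n x = S" using x assms permutes_not_in[OF x(1)] by (auto simp: moved_def)
    ultimately show "x \<in> {x \<in> symm n. moved n x = S}" by (simp add: symm_def)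
  qed
  then show ?thesis
    using bij_betw_same_card[OF bij_betw_derangements[OF f]]
    by (simp add: derangements_def symm_def atLeast0LessThan Ball_def)
qed

lemma sum_ball:
  fixes \<phi> :: "nat set \<Rightarrow> real"
  shows "(\<Sum>x\<in>ball n r. \<phi> (moved n x))
    = (\<Sum>j=0..r. real (derangements j) * (\<Sum>S | S \<subseteq> {0..<n} \<and> card S = j. \<phi> S))"
proof -
  let ?F = "{S. S \<subseteq> {0..<n} \<and> card S \<le> r}"
  have finF: "finite ?F" by simp
  have "(\<Sum>x\<in>ball n r. \<phi> (moved n x)) = (\<Sum>S\<in>?F. \<Sum>x\<in>{x \<in> ball n r. moved n x = S}. \<phi> (moved n x))"
    by (rule sum.group[symmetric, OF finite_ball finF]) (auto simp: ball_def moved_def)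
  also have "\<dots> = (\<Sum>S\<in>?F. real (derangements (card S)) * \<phi> S)"
  proof (rule sum.cong[OF refl])
    fix S assume S: "S \<in> ?F"
    then have "{x \<in> ball n r. moved n x = S} = {x \<in> symm n. moved n x = S}"
      by (auto simp: ball_def)
    then show "(\<Sum>x\<in>{x \<in> ball n r. moved n x = S}. \<phi> (moved n x)) = real (derangements (card S)) * \<phi> S"
      using card_moved_eq S by simp
  qed
  also have "\<dots> = (\<Sum>j=0..r. \<Sum>S\<in>{S \<in> ?F. card S = j}. real (derangements (card S)) * \<phi> S)"
    by (rule sum.group[symmetric, OF finF]) auto
  also have "\<dots> = (\<Sum>j=0..r. real (derangements j) * (\<Sum>S | S \<subseteq> {0..<n} \<and> card S = j. \<phi> S))"
    unfolding sum_distrib_left by (intro sum.cong) auto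
  finally show ?thesis .
qed

lemma sum_ball_card:
  fixes g :: "nat \<Rightarrow> real"
  shows "(\<Sum>x\<in>ball n r. g (card (moved n x)))
    = (\<Sum>j=0..r. real ((n choose j) * derangements j) * g j)"
proof -
  have "card {S. S \<subseteq> {0..<n} \<and> card S = j} = n choose j" for j
    using n_subsets[of "{0..<n}" j] by simp
  then show ?thesis using sum_ball[of "\<lambda>S. g (card S)" n r] by (simp add: mult_ac)
qed

lemma card_ball: "card (ball n r) = ball_size n r"
  using sum_ball_card[of "\<lambda>_. 1" n r] unfolding ball_size_def
  by (simp flip: of_nat_sum of_nat_mult)

section \<open>Growth of the spheres with their radius\<close>

text \<open>Insert the new point \<open>i\<close> into a cycle of a derangement \<open>p\<close>,
  between \<open>j\<close> and \<open>p j\<close>. The result is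
  \<open>p \<circ> transpose j i\<close>; it determines \<open>j\<close> as the preimage of
  \<open>i\<close>, and then \<open>p\<close>.\<close>

lemma derangements_Suc_ge: "i * derangements i \<le> derangements (Suc i)"
proof -
  let ?D = "\<lambda>k. {p \<in> symm k. \<forall>i<k. p i \<noteq> i}"
  let ?f = "\<lambda>(p, j). p \<circ> transpose j i"
  have fin: "finite (?D k)" for k using finite_symm by simp
  have vals: "(p \<circ> transpose j i) j = i" "(p \<circ> transpose j i) i = p j"
    "k \<noteq> j \<Longrightarrow> k \<noteq> i \<Longrightarrow> (p \<circ> transpose j i) k = p k" if "p \<in> ?D i" for p j k
    using that permutes_not_in[of p "{0..<i}" i] by (auto simp: symm_def transpose_def)
  have "inj_on ?f (?D i \<times> {0..<i})"
  proof (rule inj_onI, clarify)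
    fix p j p' j'
    assume p: "p \<in> symm i" "\<forall>k<i. p k \<noteq> k" "j \<in> {0..<i}"
      and p': "p' \<in> symm i" "\<forall>k<i. p' k \<noteq> k" "j' \<in> {0..<i}"
      and eq: "p \<circ> transpose j i = p' \<circ> transpose j' i"
    have "(p \<circ> transpose j i) j = (p \<circ> transpose j i) j'"
      using vals(1)[of p j] vals(1)[of p' j'] p p' eq by simp
    moreover have "inj (p \<circ> transpose j i)"
      using p permutes_inj[of p "{0..<i}"] permutes_inj[OF permutes_swap_id[of j UNIV i]]
      by (intro inj_compose) (auto simp: symm_def)
    ultimately have "j = j'" by (rule injD[rotated])
    moreover have "p = p \<circ> transpose j i \<circ> transpose j i" for p :: "nat \<Rightarrow> nat"
      by (simp add: comp_assoc)
    ultimately show "p = p' \<and> j = j'" using eq by metis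
  qed
  moreover have "?f ` (?D i \<times> {0..<i}) \<subseteq> ?D (Suc i)"
  proof clarify
    fix p j assume p: "p \<in> symm i" "\<forall>k<i. p k \<noteq> k" "j \<in> {0..<i}"
    have perm: "p permutes {0..<i}" using p by (simp add: symm_def)
    have "p permutes {0..<Suc i}" by (rule permutes_subset[OF perm]) auto
    moreover have "transpose j i permutes {0..<Suc i}" using p by (intro permutes_swap_id) auto
    ultimately have "p \<circ> transpose j i permutes {0..<Suc i}" by (rule permutes_compose[rotated])
    moreover have "p j < i" using permutes_in_image[OF perm, of j] p by simp
    then have "(p \<circ> transpose j i) k \<noteq> k" if "k < Suc i" for k
      using vals[of p j] p that by (cases "k = j"; cases "k = i") auto
    ultimately show "(p \<circ> transpose j i \<in> symm (Suc i)) \<and> (\<forall>k<Suc i. (p \<circ> transpose j i) k \<noteq> k)"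
      by (simp add: symm_def)
  qed
  ultimately have "card (?D i \<times> {0..<i}) \<le> card (?D (Suc i))"
    using card_inj_on_le fin by blast
  then show ?thesis by (simp add: derangements_def card_cartesian_product mult.commute)
qed

text \<open>The number of permutations at distance exactly \<open>j\<close> from the identity:
  choose the support, then a derangement of it.\<close>

definition sphere_size :: "nat \<Rightarrow> nat \<Rightarrow> real" where
  "sphere_size n j = real ((n choose j) * derangements j)"

lemma derangements_0: "derangements 0 = 1"
  by (simp add: derangements_def symm_def)

lemma derangements_2: "1 \<le> derangements 2"
proof -
  have "transpose 0 1 \<in> {p \<in> symm 2. \<forall>i<2. p i \<noteq> i}"
    by (auto simp: symm_def less_2_cases_iff intro!: permutes_swap_id)
  moreover have "finite {p \<in> symm 2. \<forall>i<2. p i \<noteq> i}"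
    using finite_symm by simp
  ultimately have "0 < card {p \<in> symm 2. \<forall>i<2. p i \<noteq> i}"
    unfolding card_gt_0_iff by blast
  then show ?thesis unfolding derangements_def by linarith
qed

text \<open>Passing to the next sphere multiplies the binomial by \<open>(n - i) / (i + 1)\<close>
  and the derangements by at least \<open>i\<close>. As \<open>i / (i + 1) \<ge> 1 / 2\<close> and
  \<open>n - i \<ge> n / 2\<close>, the gain is at least \<open>n / 4 \<ge> 2 * q\<close>. The proof
  clears denominators because \<open>derangements i\<close> may vanish.\<close>

lemma sphere_size_Suc_ge:
  fixes q :: real
  assumes i: "1 \<le> i" "2 * i \<le> n" and q: "0 \<le> q" "8 * q \<le> n"
  shows "2 * q * sphere_size n i \<le> sphere_size n (Suc i)"
proof -
  let ?D = "\<lambda>i. real (derangements i)" and ?C = "\<lambda>i. real (n choose i)"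
  have "Suc i * (n choose Suc i) = (n - i) * (n choose i)"
    by (metis binomial_absorb_comp binomial_absorption)
  then have C: "real (Suc i) * ?C (Suc i) = real (n - i) * ?C i"
    by (metis of_nat_mult)
  have D: "real i * ?D i \<le> ?D (Suc i)"
    using derangements_Suc_ge[of i] by (metis of_nat_le_iff of_nat_mult)
  have "real (Suc i) * 2 * q \<le> real i * 4 * q"
    using i q by (intro mult_right_mono) auto
  also have "\<dots> \<le> real i * real (n - i)"
    using i q by (simp add: mult_left_mono of_nat_diff)
  finally have "real (Suc i) * 2 * q * (?C i * ?D i) \<le> real i * real (n - i) * (?C i * ?D i)"
    by (intro mult_right_mono) auto
  also have "\<dots> = real (Suc i) * ?C (Suc i) * (real i * ?D i)"
    unfolding C by (simp only: mult_ac)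
  also have "\<dots> \<le> real (Suc i) * ?C (Suc i) * ?D (Suc i)"
    using D by (intro mult_left_mono) auto
  finally have "real (Suc i) * (2 * q * sphere_size n i) \<le> real (Suc i) * sphere_size n (Suc i)"
    by (simp only: sphere_size_def of_nat_mult mult_ac)
  then show ?thesis by (simp only: mult_le_cancel_left_pos of_nat_0_less_iff zero_less_Suc)
qed

text \<open>Almost the whole ball sits on its outermost spheres, so that geometric weights cost only a
  constant factor. The centre needs separate treatment because \<open>D\<^sub>1 = 0\<close>.\<close>

lemma weighted_ball_le:
  fixes q :: real
  assumes q: "1 \<le> q" "8 * q \<le> n" and d: "3 \<le> d" "2 * d \<le> n"
  shows "(\<Sum>j=0..d-1. sphere_size n j * q ^ (d - j)) \<le> (2 * q + q ^ 3) * ball_size n (d - 1)"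
proof -
  let ?W = "sphere_size n"
  have step: "2 * q * ?W i \<le> ?W (Suc i)" if "1 \<le> i" "i < d" for i
    using that q d by (intro sphere_size_Suc_ge) auto
  have W0: "0 \<le> ?W i" for i by (simp add: sphere_size_def)
  \<comment> \<open>Moving out by one sphere multiplies the weighted sum by \<open>q\<close>, to at
    most \<open>2 * q * ?W m\<close>, which is no more than the new sphere itself; so the constant 2
    persists.\<close>
  have outer: "m < d \<Longrightarrow> (\<Sum>j=1..m. ?W j * q ^ (m - j)) \<le> 2 * ?W m" if "1 \<le> m" for m
    using that
  proof (induction m rule: dec_induct)
    case base
    then show ?case using W0[of 1] by simp
  next
    case (step m)
    have "(\<Sum>j=1..Suc m. ?W j * q ^ (Suc m - j)) = (\<Sum>j=1..m. ?W j * q ^ (Suc m - j)) + ?W (Suc m)"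
      by simp
    also have "(\<Sum>j=1..m. ?W j * q ^ (Suc m - j)) = q * (\<Sum>j=1..m. ?W j * q ^ (m - j))"
      unfolding sum_distrib_left by (intro sum.cong refl) (auto simp: Suc_diff_le)
    also have "\<dots> \<le> q * (2 * ?W m)"
      using step q by (intro mult_left_mono) auto
    also have "\<dots> \<le> ?W (Suc m)"
      using \<open>\<And>i. 1 \<le> i \<Longrightarrow> i < d \<Longrightarrow> 2 * q * ?W i \<le> ?W (Suc i)\<close>[of m] step by simp
    finally show ?case by simp
  qed
  \<comment> \<open>This controls the weight of the centre. The chain of spheres starts at radius 2,
    the first one beyond the centre that is nonempty.\<close>
  have inner: "m < d \<Longrightarrow> q ^ m \<le> q\<^sup>2 * ?W m" if "2 \<le> m" for m
    using that
  proof (induction m rule: dec_induct)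
    case base
    have "1 \<le> n choose 2" using d by (simp add: Suc_leI)
    then have "1 * 1 \<le> (n choose 2) * derangements 2"
      using derangements_2 by (intro mult_mono) auto
    then have "1 \<le> ?W 2" unfolding sphere_size_def by linarith
    then show ?case using q by simp
  next
    case (step m)
    have "q ^ Suc m = q * q ^ m" by simp
    also have "\<dots> \<le> q * (q\<^sup>2 * ?W m)" using step q by (intro mult_left_mono) auto
    also have "\<dots> = q\<^sup>2 * (q * ?W m)" by simp
    also have "\<dots> \<le> q\<^sup>2 * ?W (Suc m)"
    proof (intro mult_left_mono)
      have "0 \<le> q * ?W m" using q W0[of m] by simp
      then show "q * ?W m \<le> ?W (Suc m)"
        using \<open>\<And>i. 1 \<le> i \<Longrightarrow> i < d \<Longrightarrow> 2 * q * ?W i \<le> ?W (Suc i)\<close>[of m] step by simp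
    qed simp
    finally show ?case .
  qed
  have "?W (d - 1) \<le> (\<Sum>j=0..d-1. ?W j)"
    using W0 by (intro member_le_sum) auto
  also have "\<dots> = ball_size n (d - 1)"
    unfolding sphere_size_def ball_size_def by (simp only: of_nat_sum)
  finally have last: "?W (d - 1) \<le> ball_size n (d - 1)" .
  have "(\<Sum>j=0..d-1. ?W j * q ^ (d - j)) = q ^ d + (\<Sum>j=1..d-1. ?W j * q ^ (d - j))"
    by (subst sum.atLeast_Suc_atMost) (auto simp: sphere_size_def derangements_0)
  also have "(\<Sum>j=1..d-1. ?W j * q ^ (d - j)) = q * (\<Sum>j=1..d-1. ?W j * q ^ (d - 1 - j))"
    unfolding sum_distrib_left
  proof (intro sum.cong refl)
    fix j assume "j \<in> {1..d-1}"
    then have "d - j = Suc (d - 1 - j)" using d by auto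
    then show "?W j * q ^ (d - j) = q * (?W j * q ^ (d - 1 - j))" by simp
  qed
  also have "\<dots> \<le> q * (2 * ?W (d - 1))"
    using outer[of "d - 1"] d q by (intro mult_left_mono) auto
  also have "q ^ d = q * q ^ (d - 1)" using d by (simp add: power_eq_if)
  also have "\<dots> \<le> q * (q\<^sup>2 * ?W (d - 1))"
    using inner[of "d - 1"] d q by (intro mult_left_mono) auto
  finally have "(\<Sum>j=0..d-1. ?W j * q ^ (d - j)) \<le> (2 * q + q ^ 3) * ?W (d - 1)"
    by (simp add: algebra_simps power2_eq_square power3_eq_cube)
  also have "\<dots> \<le> (2 * q + q ^ 3) * ball_size n (d - 1)"
    using last q by (intro mult_left_mono) auto
  finally show ?thesis .
qed

text \<open>A point in exactly one of the two supports is moved by one permutation and fixed by the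
  other, so the symmetric difference of the supports counts towards the distance.\<close>

lemma card_moved_le_hamming_dist:
  "card (moved n x) + card (moved n y)
    \<le> hamming_dist n x y + 2 * card (moved n x \<inter> moved n y)"
proof -
  let ?A = "moved n x" and ?B = "moved n y"
  have "card (?A - ?B) + card (?B - ?A) = card ((?A - ?B) \<union> (?B - ?A))"
    by (rule card_Un_disjoint[symmetric]) (auto simp: finite_moved)
  also have "\<dots> \<le> hamming_dist n x y"
    unfolding hamming_dist_def by (rule card_mono) (auto simp: moved_def)
  finally show ?thesis
    using card_Int_Diff[OF finite_moved, of n x ?B] card_Int_Diff[OF finite_moved, of n y ?A]
    by (simp add: Int_commute)
qed

lemma hamming_dist_comp:
  assumes "inj p"
  shows "hamming_dist n (p \<circ> x) (p \<circ> y) = hamming_dist n x y"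
  using assms by (simp add: hamming_dist_def inj_eq)

lemma card_moved_comp_inv:
  assumes "v \<in> symm n"
  shows "card (moved n (inv v \<circ> x)) = hamming_dist n v x"
proof -
  have "v permutes {0..<n}" using assms by (simp add: symm_def)
  then have "moved n (inv v \<circ> x) = {i \<in> {0..<n}. v i \<noteq> x i}"
    by (auto simp: moved_def permutes_inv_eq)
  then show ?thesis by (simp add: hamming_dist_def)
qed

section \<open>Close pairs in a ball\<close>

text \<open>The pairs are ordered and include the diagonal; the diagonal later yields a lower bound
  on the ball size.\<close>

definition close_pairs :: "nat \<Rightarrow> nat \<Rightarrow> ((nat \<Rightarrow> nat) \<times> (nat \<Rightarrow> nat)) set" where
  "close_pairs n r = {(x, y). x \<in> ball n r \<and> y \<in> ball n r \<and> hamming_dist n x y \<le> r}"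

lemma finite_close_pairs: "finite (close_pairs n r)"
  by (rule finite_subset[of _ "ball n r \<times> ball n r"]) (auto simp: close_pairs_def finite_ball)

text \<open>Here \<open>A\<close> stands for the support of the other element of a pair. On each
  sphere the support of \<open>y\<close> is a uniformly random set of density at most \<alpha>, so
  \<open>hypergeometric_mgf_le\<close> with \<open>s = q^2 - 1\<close> applies.\<close>

lemma tilted_ball_sum_le:
  fixes q \<alpha> :: real
  assumes q: "1 \<le> q" and d: "0 < d" "real d = \<alpha> * real n" and n: "0 < n" "d \<le> n"
    and A: "A \<subseteq> {0..<n}" "card A \<le> d"
  shows "(\<Sum>y\<in>ball n (d-1). q ^ (d - card (moved n y)) * (q\<^sup>2) ^ card (A \<inter> moved n y))
    \<le> (1 + (q\<^sup>2 - 1) * \<alpha>) ^ d * (\<Sum>j=0..d-1. sphere_size n j * q ^ (d - j))"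
proof -
  let ?b = "1 + (q\<^sup>2 - 1) * \<alpha>"
  have s: "0 \<le> q\<^sup>2 - 1" using q by simp
  have "0 \<le> \<alpha>" using d n by (metis of_nat_0_le_iff of_nat_0_less_iff zero_le_mult_iff not_less)
  then have b: "1 \<le> ?b" using s by simp
  have "(\<Sum>y\<in>ball n (d-1). q ^ (d - card (moved n y)) * (q\<^sup>2) ^ card (A \<inter> moved n y))
      = (\<Sum>j=0..d-1. real (derangements j) *
          (\<Sum>S | S \<subseteq> {0..<n} \<and> card S = j. q ^ (d - card S) * (q\<^sup>2) ^ card (A \<inter> S)))"
    by (rule sum_ball)
  also have "\<dots> \<le> (\<Sum>j=0..d-1. ?b ^ d * (sphere_size n j * q ^ (d - j)))"
  proof (rule sum_mono)
    fix j assume j: "j \<in> {0..d-1}"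
    have "(\<Sum>S | S \<subseteq> {0..<n} \<and> card S = j. q ^ (d - card S) * (q\<^sup>2) ^ card (A \<inter> S))
        = q ^ (d - j) * (\<Sum>S | S \<subseteq> {0..<n} \<and> card S = j. (1 + (q\<^sup>2 - 1)) ^ card (A \<inter> S))"
      unfolding sum_distrib_left by (intro sum.cong) auto
    also have "(\<Sum>S | S \<subseteq> {0..<n} \<and> card S = j. (1 + (q\<^sup>2 - 1)) ^ card (A \<inter> S))
        \<le> (1 + (q\<^sup>2 - 1) * (real j / real n)) ^ card A * real (n choose j)"
      using hypergeometric_mgf_le[of "{0..<n}" A "q\<^sup>2 - 1" j] A s j n by simp
    also have "(1 + (q\<^sup>2 - 1) * (real j / real n)) ^ card A \<le> ?b ^ card A"
    proof (intro power_mono add_left_mono mult_left_mono)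
      have "real j \<le> real d" using j by auto
      then show "real j / real n \<le> \<alpha>" using d n by (simp add: field_simps)
    qed (use s in auto)
    also have "?b ^ card A \<le> ?b ^ d" using b A by (intro power_increasing) auto
    finally have "real (derangements j) *
        (\<Sum>S | S \<subseteq> {0..<n} \<and> card S = j. q ^ (d - card S) * (q\<^sup>2) ^ card (A \<inter> S))
      \<le> real (derangements j) * (q ^ (d - j) * (?b ^ d * real (n choose j)))"
      using q by (simp add: mult_left_mono mult_right_mono)
    then show "real (derangements j) *
        (\<Sum>S | S \<subseteq> {0..<n} \<and> card S = j. q ^ (d - card S) * (q\<^sup>2) ^ card (A \<inter> S))
      \<le> ?b ^ d * (sphere_size n j * q ^ (d - j))"
      unfolding sphere_size_def of_nat_mult by (simp only: mult_ac)
  qed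
  finally show ?thesis by (simp only: sum_distrib_left)
qed

text \<open>Two ball elements at distance below \<open>d\<close> have supports \<open>A\<close>, \<open>B\<close> with
  \<open>card A + card B - 2 * card (A \<inter> B) < d\<close>; this event is bounded by an exponential moment.\<close>

lemma card_close_pairs_le:
  fixes q \<alpha> :: real
  assumes q: "1 \<le> q" and d: "0 < d" "real d = \<alpha> * real n" and n: "0 < n" "d \<le> n"
  shows "card (close_pairs n (d-1)) * q ^ d
    \<le> (1 + (q\<^sup>2 - 1) * \<alpha>) ^ d * (\<Sum>j=0..d-1. sphere_size n j * q ^ (d - j))\<^sup>2"
proof -
  let ?B = "ball n (d-1)" and ?F = "\<Sum>j=0..d-1. sphere_size n j * q ^ (d - j)"
  let ?b = "1 + (q\<^sup>2 - 1) * \<alpha>" and ?m = "\<lambda>x. card (moved n x)"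
  let ?g = "\<lambda>x y. q ^ (d - ?m x) * (q ^ (d - ?m y) * (q\<^sup>2) ^ card (moved n x \<inter> moved n y))"
  have "card (close_pairs n (d-1)) * q ^ d = (\<Sum>(x, y)\<in>close_pairs n (d-1). q ^ d)"
    by simp
  also have "\<dots> \<le> (\<Sum>(x, y)\<in>close_pairs n (d-1). ?g x y)"
  proof (rule sum_mono, clarify)
    fix x y assume "(x, y) \<in> close_pairs n (d-1)"
    then have xy: "?m x \<le> d - 1" "?m y \<le> d - 1" "hamming_dist n x y \<le> d - 1"
      by (auto simp: close_pairs_def ball_def)
    \<comment> \<open>Both supports have fewer than \<open>d\<close> points, so the differences are
      not truncated, and closeness makes the exponent of \<open>q\<close> in \<open>?g x y\<close>
      at least \<open>d\<close>. This is Markov's inequality for the exponential moment.\<close>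
    then have "d \<le> (d - ?m x) + ((d - ?m y) + 2 * card (moved n x \<inter> moved n y))"
      using card_moved_le_hamming_dist[of n x y] d by linarith
    then have "q ^ d \<le> q ^ ((d - ?m x) + ((d - ?m y) + 2 * card (moved n x \<inter> moved n y)))"
      using q by (intro power_increasing) auto
    then show "q ^ d \<le> ?g x y" by (simp only: power_add power_mult)
  qed
  also have "\<dots> \<le> (\<Sum>(x, y)\<in>?B \<times> ?B. ?g x y)"
    using q by (intro sum_mono2) (auto simp: finite_ball close_pairs_def)
  also have "\<dots> = (\<Sum>x\<in>?B. q ^ (d - ?m x)
      * (\<Sum>y\<in>?B. q ^ (d - ?m y) * (q\<^sup>2) ^ card (moved n x \<inter> moved n y)))"
    by (simp add: sum.cartesian_product[symmetric] sum_distrib_left)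
  also have "\<dots> \<le> (\<Sum>x\<in>?B. q ^ (d - ?m x) * (?b ^ d * ?F))"
  proof (intro sum_mono mult_left_mono tilted_ball_sum_le)
    fix x assume "x \<in> ?B"
    then show "?m x \<le> d" by (auto simp: ball_def)
  qed (use assms in \<open>auto simp: moved_def\<close>)
  also have "\<dots> = ?F * (?b ^ d * ?F)"
    unfolding sum_distrib_right[symmetric] sphere_size_def
    by (subst sum_ball_card[of "\<lambda>j. q ^ (d - j)"]) simp
  finally show ?thesis by (simp add: power2_eq_square mult_ac)
qed

section \<open>The lower bound\<close>

lemma card_le_max_perm_array:
  assumes "perm_array n d C"
  shows "card C \<le> max_perm_array n d"
proof -
  have "finite (card ` {C. perm_array n d C})"
    by (rule finite_imageI, rule finite_subset[of _ "Pow (symm n)"])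
      (auto simp: perm_array_def finite_symm)
  then show ?thesis
    unfolding max_perm_array_def using assms by (intro Max_ge) (auto simp: setcompr_eq_image)
qed

lemma max_perm_array_ge_1: "1 \<le> max_perm_array n d"
proof -
  have "perm_array n d {id}" by (simp add: perm_array_def symm_def)
  then show ?thesis using card_le_max_perm_array by fastforce
qed

lemma ball_size_ge_1: "1 \<le> ball_size n r"
proof -
  have "(n choose 0) * derangements 0 \<le> ball_size n r"
    unfolding ball_size_def by (rule member_le_sum) auto
  then show ?thesis by (simp add: derangements_0)
qed

lemma log_binary_ball_size_le: "log 2 (real (binary_ball_size n r)) \<le> n"
proof -
  have "n choose 0 \<le> binary_ball_size n r"
    unfolding binary_ball_size_def by (rule member_le_sum) auto
  then have pos: "0 < real (binary_ball_size n r)" by simp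
  have "binary_ball_size n r \<le> 2 ^ n"
  proof -
    have "binary_ball_size n r = (\<Sum>i\<in>{0..r} \<inter> {..n}. n choose i)"
      unfolding binary_ball_size_def by (intro sum.mono_neutral_right) auto
    also have "\<dots> \<le> (\<Sum>i\<le>n. n choose i)" by (rule sum_mono2) auto
    finally show ?thesis by (simp add: choose_row_sum)
  qed
  then have "real (binary_ball_size n r) \<le> 2 powr real n"
    by (simp add: powr_realpow)
  then show ?thesis using pos by (simp add: log_le_iff)
qed

text \<open>The distance is invariant under composition on the left. Composing with
  \<open>inv v\<close> carries the neighbourhood of \<open>v\<close> into the ball about the
  identity and its adjacent pairs into \<open>close_pairs\<close>, so one count serves all
  vertices.\<close>

lemma max_perm_array_ge:
  fixes l L :: real
  assumes d: "0 < d" and l: "0 < l" "l \<le> 1"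
    and pairs: "l\<^sup>2 * card (close_pairs n (d-1)) \<le> 1"
    and L: "0 \<le> L" "exp (2 + 6 * L) \<le> l * ball_size n (d-1)"
  shows "L * fact n \<le> 2 * real (ball_size n (d-1)) * max_perm_array n d"
proof -
  define E where "E = (\<lambda>x y. x \<noteq> y \<and> hamming_dist n x y < d)"
  have E_iff: "E x y \<longleftrightarrow> x \<noteq> y \<and> hamming_dist n x y < d" for x y
    by (simp add: E_def)
  interpret finite_graph "symm n" E
  proof
    have "hamming_dist n x y = hamming_dist n y x" for x y
      unfolding hamming_dist_def by metis
    then show "E x y \<Longrightarrow> E y x" for x y unfolding E_iff by metis
  qed (auto simp: E_iff finite_symm)
  have comp: "inv v \<circ> x \<in> ball n (d-1)" if "v \<in> symm n" "x \<in> nbhd v" for v x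
  proof -
    have x: "x \<in> symm n" "hamming_dist n v x < d"
      using that by (simp_all add: nbhd_def E_iff)
    then have "inv v \<circ> x \<in> symm n"
      using that permutes_compose permutes_inv unfolding symm_def by blast
    then show ?thesis
      using x card_moved_comp_inv[OF that(1), of x] by (simp add: ball_def)
  qed
  have inj: "inj (inv v)" if "v \<in> symm n" for v
    using that permutes_inj permutes_inv unfolding symm_def by blast
  have "\<exists>I\<in>indep (symm n). L * card (symm n) \<le> 2 * real (ball_size n (d-1)) * card I"
  proof (rule ex_large_independent_set[OF l _ _ pairs L])
    fix v assume v: "v \<in> symm n"
    have injc: "inj_on ((\<circ>) (inv v)) A" for A :: "(nat \<Rightarrow> nat) set"
      using inj_on_subset[OF fun.inj_map[OF inj[OF v]]] by simp
    have "card (nbhd v) \<le> card (ball n (d-1))"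
      by (rule card_inj_on_le[OF injc]) (use comp v finite_ball in auto)
    then show "real (card (nbhd v)) \<le> real (ball_size n (d-1))" by (simp add: card_ball)
    have "card {(x, y). x \<in> nbhd v \<and> y \<in> nbhd v \<and> E x y} \<le> card (close_pairs n (d-1))"
    proof (rule card_inj_on_le[OF _ _ finite_close_pairs])
      show "inj_on (map_prod ((\<circ>) (inv v)) ((\<circ>) (inv v))) {(x, y). x \<in> nbhd v \<and> y \<in> nbhd v \<and> E x y}"
        using map_prod_inj_on[OF injc[of UNIV] injc[of UNIV]] by (rule inj_on_subset) auto
      show "map_prod ((\<circ>) (inv v)) ((\<circ>) (inv v)) ` {(x, y). x \<in> nbhd v \<and> y \<in> nbhd v \<and> E x y}
          \<subseteq> close_pairs n (d-1)"
        using comp v hamming_dist_comp[OF inj[OF v]] by (auto simp: close_pairs_def E_iff)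
    qed
    then show "real (card {(x, y). x \<in> nbhd v \<and> y \<in> nbhd v \<and> E x y}) \<le> card (close_pairs n (d-1))"
      by simp
  qed
  then obtain I where I: "I \<in> indep (symm n)"
    and large: "L * card (symm n) \<le> 2 * real (ball_size n (d-1)) * card I" by blast
  have "perm_array n d I"
    using I by (auto simp: indep_def E_iff perm_array_def not_less)
  then have "2 * real (ball_size n (d-1)) * card I \<le> 2 * real (ball_size n (d-1)) * max_perm_array n d"
    using card_le_max_perm_array by (intro mult_left_mono) auto
  moreover have "card (symm n) = fact n"
    unfolding symm_def by (rule card_permutations) auto
  ultimately show ?thesis using large by simp
qed

lemma ex_linear_gain:
  fixes \<alpha> :: real
  assumes \<alpha>: "0 < \<alpha>" "\<alpha> < 1 / 2"
  shows "\<exists>b::real>0. \<exists>N. \<forall>n\<ge>N. \<forall>d. 0 < d \<longrightarrow> real d = \<alpha> * real n \<longrightarrow>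
    b * n * fact n \<le> ball_size n (d-1) * max_perm_array n d"
proof -
  \<comment> \<open>The decay rate satisfies \<kappa> < 1 exactly when
    \<open>(q - 1) * ((q + 1) * \<alpha> - 1) < 0\<close>, that is, for \<open>q\<close> between 1
    and \<open>1 / \<alpha> - 1\<close>. This interval is nonempty because \<alpha> < 1/2, and
    \<open>q\<close> is its midpoint.\<close>
  define q where "q = 1 / (2 * \<alpha>)"
  define \<kappa> where "\<kappa> = (1 + (q\<^sup>2 - 1) * \<alpha>) / q"
  define K where "K = (2 * q + q ^ 3)\<^sup>2"
  \<comment> \<open>Thus \<open>\<kappa> ^ d = exp (- \<delta> * n)\<close>. Half of this decay
    absorbs the constant \<open>K\<close>, and the other half is \<open>exp (- 2 * (b * n))\<close>.
    The summands of \<open>N\<close> give, in order, \<open>8 * q \<le> n\<close>,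
    \<open>3 \<le> d\<close>, \<open>K \<le> \<delta> * n / 2\<close> and
    \<open>4 \<le> b * n\<close>.\<close>
  define \<delta> where "\<delta> = - \<alpha> * ln \<kappa>"
  define b where "b = \<delta> / 4"
  define N where "N = nat \<lceil>8 * q + 3 / \<alpha> + 2 * K / \<delta> + 4 / b\<rceil>"
  have q: "1 < q" using \<alpha> by (simp add: q_def)
  have "(q - 1) * ((q + 1) * \<alpha> - 1) < 0"
    using \<alpha> q by (intro mult_pos_neg) (auto simp: q_def field_simps)
  then have "1 + (q\<^sup>2 - 1) * \<alpha> < q" by (simp add: algebra_simps power2_eq_square)
  then have \<kappa>1: "\<kappa> < 1" using q by (simp add: \<kappa>_def)
  have "0 \<le> (q\<^sup>2 - 1) * \<alpha>" using q \<alpha> by simp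
  then have \<kappa>0: "0 < \<kappa>" using q by (simp add: \<kappa>_def)
  have \<delta>: "0 < \<delta>" using \<alpha> \<kappa>0 \<kappa>1 by (simp add: \<delta>_def mult_less_0_iff)
  then have b: "0 < b" by (simp add: b_def)
  have K: "0 \<le> K" by (simp add: K_def)
  have "b / 24 * n * fact n \<le> ball_size n (d-1) * max_perm_array n d"
    if n: "N \<le> n" and d: "0 < d" "real d = \<alpha> * real n" for n d
  proof -
    let ?M = "real (ball_size n (d-1))" and ?T = "real (card (close_pairs n (d-1)))"
    have bound: "8 * q + 3 / \<alpha> + 2 * K / \<delta> + 4 / b \<le> n"
      using n unfolding N_def by linarith
    have pos: "0 < 8 * q" "0 < 3 / \<alpha>" "0 \<le> 2 * K / \<delta>" "0 < 4 / b"
      using q \<alpha> K \<delta> b by auto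
    have n1: "8 * q \<le> n" and "3 / \<alpha> \<le> n" and "2 * K / \<delta> \<le> n" and "4 / b \<le> n"
      using bound pos by linarith+
    then have n2: "3 \<le> \<alpha> * n" and n3: "K \<le> \<delta> * n / 2" and n4: "4 \<le> b * n"
      using \<alpha> \<delta> b by (auto simp: field_simps)
    have n0: "0 < n" using n1 q by (cases n) auto
    have "2 * \<alpha> * real n \<le> 1 * real n" using \<alpha> by (intro mult_right_mono) auto
    then have d': "3 \<le> d" "2 * d \<le> n" "d \<le> n" using d n2 by linarith+
    have M: "1 \<le> ?M" using ball_size_ge_1[of n "d-1"] by linarith
    have "?T * q ^ d \<le> (1 + (q\<^sup>2 - 1) * \<alpha>) ^ d * (\<Sum>j=0..d-1. sphere_size n j * q ^ (d - j))\<^sup>2"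
      using card_close_pairs_le q d n0 d' by auto
    also have "(\<Sum>j=0..d-1. sphere_size n j * q ^ (d - j))\<^sup>2 \<le> ((2 * q + q ^ 3) * ?M)\<^sup>2"
      using weighted_ball_le[of q n d] q n1 d'
      by (intro power_mono sum_nonneg) (auto simp: sphere_size_def)
    finally have "?T * q ^ d \<le> (1 + (q\<^sup>2 - 1) * \<alpha>) ^ d * (K * ?M\<^sup>2)"
      using \<open>0 \<le> (q\<^sup>2 - 1) * \<alpha>\<close> by (simp add: mult_left_mono K_def power_mult_distrib)
    then have "?T \<le> \<kappa> ^ d * K * ?M\<^sup>2"
      using q by (simp add: \<kappa>_def power_divide field_simps)
    also have "\<kappa> ^ d = exp (- \<delta> * n)"
    proof -
      have "\<kappa> ^ d = exp (ln \<kappa>) ^ d" using \<kappa>0 by simp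
      also have "\<dots> = exp (real d * ln \<kappa>)" by (rule exp_of_nat_mult[symmetric])
      finally show ?thesis using d by (simp add: \<delta>_def mult_ac)
    qed
    also have "exp (- \<delta> * n) * K * ?M\<^sup>2 \<le> exp (- \<delta> * n) * exp (\<delta> * n / 2) * ?M\<^sup>2"
      using order_trans[OF n3 order_trans[OF _ exp_ge_add_one_self]]
      by (intro mult_right_mono mult_left_mono) auto
    also have "exp (- \<delta> * n) * exp (\<delta> * n / 2) = exp (- 2 * (b * n))"
      unfolding exp_add[symmetric] by (simp add: b_def)
    finally have T: "?T \<le> exp (- 2 * (b * n)) * ?M\<^sup>2" .
    \<comment> \<open>With this fugacity, \<open>l^2\<close> times the bound on \<open>?T\<close> is
      exactly 1.\<close>
    define l where "l = exp (b * n) / ?M"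
    \<comment> \<open>For \<open>l \<le> 1\<close> the ball must have at least
      \<open>exp (b * n)\<close> elements. The diagonal gives this without estimating
      \<open>ball_size\<close>: \<open>?M \<le> ?T \<le> exp (- 2 * (b * n)) * ?M^2\<close>.\<close>
    have "(\<lambda>x. (x, x)) ` ball n (d-1) \<subseteq> close_pairs n (d-1)"
      by (auto simp: close_pairs_def hamming_dist_def)
    then have "card ((\<lambda>x. (x, x)) ` ball n (d-1)) \<le> card (close_pairs n (d-1))"
      by (rule card_mono[OF finite_close_pairs])
    then have "?M \<le> ?T"
      by (simp add: card_image inj_on_def card_ball)
    then have "?M * 1 \<le> ?M * (exp (- 2 * (b * n)) * ?M)"
      using T by (simp add: power2_eq_square mult_ac)
    then have "1 \<le> exp (- 2 * (b * n)) * ?M"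
      using M by (subst (asm) mult_le_cancel_left_pos) auto
    then have "exp (2 * (b * n)) \<le> ?M"
      by (simp add: exp_minus field_simps)
    moreover have "exp (b * n) \<le> exp (2 * (b * n))" using b by simp
    ultimately have "exp (b * n) \<le> ?M" by linarith
    then have l1: "l \<le> 1" using M by (simp add: l_def)
    have "l\<^sup>2 * ?T \<le> l\<^sup>2 * (exp (- 2 * (b * n)) * ?M\<^sup>2)"
      using T by (intro mult_left_mono) auto
    also have "\<dots> = (exp (b * n))\<^sup>2 * exp (- 2 * (b * n))"
      using M by (simp add: l_def power_divide)
    also have "\<dots> = 1"
      by (simp add: power2_eq_square exp_add[symmetric])
    finally have pairs: "l\<^sup>2 * ?T \<le> 1" .
    \<comment> \<open>The solution of \<open>exp (2 + 6 * L) = l * ?M\<close>. It is at least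
      \<open>b * n / 12\<close> because \<open>4 \<le> b * n\<close>; the factor 2 of
      \<open>max_perm_array_ge\<close> turns 12 into 24.\<close>
    define L where "L = (b * n - 2) / 6"
    have L: "b * n / 12 \<le> L" "0 \<le> L" using n4 by (auto simp: L_def field_simps)
    have "L * fact n \<le> 2 * ?M * max_perm_array n d"
    proof (rule max_perm_array_ge[OF d(1) _ l1 pairs L(2)])
      show "0 < l" using M by (simp add: l_def)
      have "2 + 6 * L = b * n" by (simp add: L_def field_simps)
      then show "exp (2 + 6 * L) \<le> l * ?M" using M by (simp add: l_def)
    qed
    moreover have "b * n / 12 * fact n \<le> L * fact n"
      using L by (intro mult_right_mono) auto
    ultimately have "b * n / 12 * fact n \<le> 2 * ?M * max_perm_array n d" by linarith
    moreover have "b / 24 * n * fact n = b * n / 12 * fact n / 2" by simp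
    ultimately show ?thesis unfolding of_nat_mult by linarith
  qed
  then show ?thesis using b by (intro exI[of _ "b / 24"] conjI) auto
qed

theorem theorem2:
  fixes \<alpha> :: real
  assumes "0 < \<alpha>" and "\<alpha> < 1 / 2"
  shows "\<exists>c::real. 0 < c \<and>
    (\<forall>n d :: nat. 0 < n \<longrightarrow> 0 < d \<longrightarrow> real d = \<alpha> * real n \<longrightarrow>
      real (max_perm_array n d)
        \<ge> c * (fact n / real (ball_size n (d - 1))) * log 2 (real (binary_ball_size n (d - 1))))"
proof -
  obtain b :: real and N where b: "0 < b" and gain: "\<And>n d. N \<le> n \<Longrightarrow> 0 < d \<Longrightarrow> real d = \<alpha> * real n \<Longrightarrow>
      b * n * fact n \<le> ball_size n (d-1) * max_perm_array n d"
    using ex_linear_gain[OF assms] by blast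
  have N: "0 < fact N * (real N + 1)" by simp
  \<comment> \<open>The second entry handles the finitely many \<open>n < N\<close>: there it pushes
    the right-hand side below 1, and a single permutation is always an array.\<close>
  define c where "c = min b (1 / (fact N * (real N + 1)))"
  have c: "0 < c" "c \<le> b" "c \<le> 1 / (fact N * (real N + 1))"
    using b N by (auto simp: c_def)
  have "c * (fact n / real (ball_size n (d - 1))) * log 2 (real (binary_ball_size n (d - 1)))
      \<le> real (max_perm_array n d)"
    if "0 < n" "0 < d" "real d = \<alpha> * real n" for n d
  proof -
    let ?M = "real (ball_size n (d-1))"
    have M: "1 \<le> ?M" using ball_size_ge_1[of n "d-1"] by linarith
    have "c * (fact n / ?M) * log 2 (real (binary_ball_size n (d - 1))) \<le> c * (fact n / ?M) * n"
      using c log_binary_ball_size_le by (intro mult_left_mono) auto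
    also have "\<dots> \<le> real (max_perm_array n d)"
    proof (cases "N \<le> n")
      case True
      have "c * (n * fact n) \<le> b * (n * fact n)" using c by (intro mult_right_mono) auto
      also have "\<dots> \<le> ?M * max_perm_array n d" using gain[OF True that(2,3)] by simp
      finally show ?thesis using M by (simp add: field_simps)
    next
      case False
      have "c * (fact n / ?M) * n \<le> 1 / (fact N * (real N + 1)) * (fact N / 1) * (real N + 1)"
        using c M False by (intro mult_mono frac_le fact_mono) auto
      also have "\<dots> = 1" using N by (simp add: field_simps)
      also have "\<dots> \<le> real (max_perm_array n d)" using max_perm_array_ge_1[of n d] by linarith
      finally show ?thesis .
    qed
    finally show ?thesis .
  qed
  then show ?thesis using c(1) by blast
qed

end
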